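(* Let $S$ be a preordered semiring with $1\ge 0$ and a power universal element $u$, and let $T\subseteq S$ be a subsemiring with $u\in T$, carrying the induced preorder. Then every monotone semiring homomorphism $\phi:T\to\mathbb{R}_+$ can be extended to a monotone semiring homomorphism $S\to\mathbb{R}_+$, and every monotone semiring homomorphism $\phi:T\to\mathbb{TR}_+$ can be extended to a monotone semiring homomorphism $S\to\mathbb{TR}_+$.
   Context: All structures are commutative. A semiring is a set with operations $+,\cdot$ and elements $0,1$ such that $(S,+,0)$ and $(S,\cdot,1)$ are commutative monoids, multiplication distributes over addition, and $0\cdot x=0$. A semiring homomorphism preserves $+,\cdot,0,1$; a subsemiring contains $0,1$ and is closed under $+,\cdot$. A preordered semiring is a semiring $S$ with a reflexive and transitive relation $\le$ such that $x\le y$ implies $a+x\le a+y$ and $ax\le ay$ for all $a,x,y\in S$. A power universal element is a nonzero $u\in S$ with $u\ge 1$ such that for all nonzero $x,y\in S$ with $x\le y$ there is $k\in\mathbb{N}$ with $y\le xu^k$. $\mathbb{R}_+$ is the semiring of nonnegative reals with the usual operations and order; $\mathbb{TR}_+$ is the set of nonnegative reals with $\max$ as addition, the usual multiplication and the usual order. *)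

theory Defs
  imports Complex_Main
begin

text \<open>
  The semiring \<open>S\<close> is a type of class \<^class>\<open>comm_semiring_1\<close>. This class includes
  \<open>0 \<noteq> 1\<close>, which is no restriction in the presence of a power universal element:
  such an element is nonzero, and the trivial semiring has no nonzero element.
  The preorder is an explicit relation because it need not be antisymmetric, whereas the
  ordered algebra classes of the library are based on partial orders.
\<close>

definition semiring_preorder :: "('a::comm_semiring_1 \<Rightarrow> 'a \<Rightarrow> bool) \<Rightarrow> bool" where
  "semiring_preorder le \<longleftrightarrow>
     reflp le \<and> transp le \<and>
     (\<forall>a x y. le x y \<longrightarrow> le (a + x) (a + y) \<and> le (a * x) (a * y))"

definition power_universal :: "('a::comm_semiring_1 \<Rightarrow> 'a \<Rightarrow> bool) \<Rightarrow> 'a \<Rightarrow> bool" where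
  "power_universal le u \<longleftrightarrow>
     u \<noteq> 0 \<and> le 1 u \<and>
     (\<forall>x y. x \<noteq> 0 \<longrightarrow> y \<noteq> 0 \<longrightarrow> le x y \<longrightarrow> (\<exists>k::nat. le y (x * u ^ k)))"

definition subsemiring :: "'a::comm_semiring_1 set \<Rightarrow> bool" where
  "subsemiring T \<longleftrightarrow>
     0 \<in> T \<and> 1 \<in> T \<and> (\<forall>x\<in>T. \<forall>y\<in>T. x + y \<in> T \<and> x * y \<in> T)"

text \<open>
  Monotone semiring homomorphisms from a subsemiring \<open>T\<close>, with the preorder induced by
  \<open>le\<close>, to the nonnegative reals with addition \<open>add\<close>, the usual multiplication, zero,
  one and order. Zero is neutral for \<^const>\<open>max\<close> on the nonnegative reals, so it is the
  additive unit in both instances below. Values of \<open>\<phi>\<close> outside \<open>T\<close> are irrelevant.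
\<close>

definition monotone_hom_wrt ::
  "(real \<Rightarrow> real \<Rightarrow> real) \<Rightarrow> ('a::comm_semiring_1 \<Rightarrow> 'a \<Rightarrow> bool) \<Rightarrow> 'a set \<Rightarrow> ('a \<Rightarrow> real) \<Rightarrow> bool" where
  "monotone_hom_wrt add le T \<phi> \<longleftrightarrow>
     \<phi> ` T \<subseteq> {0..} \<and>
     \<phi> 0 = 0 \<and> \<phi> 1 = 1 \<and>
     (\<forall>x\<in>T. \<forall>y\<in>T. \<phi> (x + y) = add (\<phi> x) (\<phi> y) \<and> \<phi> (x * y) = \<phi> x * \<phi> y) \<and>
     monotone_on T le (\<le>) \<phi>"

text \<open>The targets are \<open>\<real>\<^sub>+\<close> and the tropical semiring \<open>T\<real>\<^sub>+\<close>, respectively.\<close>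

definition monotone_hom_R ::
  "('a::comm_semiring_1 \<Rightarrow> 'a \<Rightarrow> bool) \<Rightarrow> 'a set \<Rightarrow> ('a \<Rightarrow> real) \<Rightarrow> bool" where
  "monotone_hom_R = monotone_hom_wrt (+)"

definition monotone_hom_TR ::
  "('a::comm_semiring_1 \<Rightarrow> 'a \<Rightarrow> bool) \<Rightarrow> 'a set \<Rightarrow> ('a \<Rightarrow> real) \<Rightarrow> bool" where
  "monotone_hom_TR = monotone_hom_wrt max"

end

theory Submission imports Defs begin

text \<open>
  The idea is to enlarge the preorder until it is so fine that it determines the extension.
  Comparing a nonzero \<open>x\<close> with \<open>1 + x\<close> shows that \<open>x\<close> lies between \<open>u\<^sup>-\<^sup>k\<close> and \<open>u\<^sup>k\<close> for some
  \<open>k\<close>, and the existence of \<open>\<phi>\<close> excludes \<open>1 \<le> 0\<close>, so there are no zero divisors. These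
  two-sided bounds make the problem one of real-valued growth rates.

  By Zorn's lemma there is a maximal semiring preorder that contains \<open>le\<close> and for which \<open>\<phi>\<close>
  is still monotone on \<open>T\<close>. Whenever a larger semiring preorder keeps \<open>\<phi>\<close> monotone, it
  coincides with the maximal one. This principle gives \<open>c x \<le> c y \<Longrightarrow> x \<le> y\<close> for
  \<open>c \<noteq> 0\<close>, and then totality:

  In the real case also \<open>x + e \<le> y + e \<Longrightarrow> x \<le> y\<close>. Forcing \<open>y \<le> x\<close> produces the preorder
  \<open>\<exists>c w. c \<noteq> 0 \<and> c a + w x \<le> c b + w y\<close>. If neither \<open>y \<le> x\<close> nor \<open>x \<le> y\<close> can be
  forced, the two violations add up to an inequality \<open>p a + q t \<le> p b + q s\<close> with
  \<open>a, b, s, t \<in> T\<close>, \<open>\<phi> a > \<phi> b\<close> and \<open>\<phi> t > \<phi> s\<close>. A telescoping argument with high powers of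
  \<open>a\<close> and \<open>b\<close> eliminates the coefficients \<open>p\<close> and \<open>q\<close>, which are not in \<open>T\<close>, at the
  expense of a fixed power of \<open>u\<close>; this is a contradiction (\<open>weighted_comparison\<close>).

  In the tropical case \<open>1 + 1 \<le> 1\<close>, so sums are joins, and the fractions of nonzero elements
  behave like a lattice-ordered group. Forcing \<open>y \<le> x\<close> means passing to the quotient by a convex
  subgroup, which is \<open>\<exists>n. a x\<^sup>n \<le> b (x + y)\<^sup>n\<close>. That \<open>x\<close> and \<open>y\<close> cannot both fail to be
  comparable reflects that positive and negative part of a group element have trivial meet;
  here it takes the form \<open>(x + y)\<^sup>n \<le> x\<^sup>n + y\<^sup>n\<close>.

  For a total preorder the extension can be written down. The exponents \<open>(p - q) / n\<close> with
  \<open>u\<^sup>p \<le> u\<^sup>q x\<^sup>n\<close> form a Dedekind cut, and its supremum is the logarithm of \<open>\<psi> x\<close> in base \<open>\<phi> u\<close>.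
  This \<open>\<psi>\<close> is monotone, multiplicative and extends \<open>\<phi>\<close>; additivity again follows from totality,
  by comparing multiples of elements with natural numbers in the real case and directly in the
  tropical case.
\<close>

section \<open>Comparison of real numbers\<close>

lemma le_if_powers_le:
  fixes a b C :: real
  assumes "0 \<le> b" and "\<And>n. a ^ n \<le> C * b ^ n"
  shows "a \<le> b"
proof (rule ccontr)
  assume "\<not> a \<le> b"
  hence ba: "b < a" and a: "0 < a" using assms(1) by auto
  have "(\<lambda>n. C * (b / a) ^ n) \<longlonglongrightarrow> C * 0"
    by (intro tendsto_mult tendsto_const LIMSEQ_realpow_zero) (use ba a assms(1) in auto)
  hence "\<forall>\<^sub>F n in sequentially. C * (b / a) ^ n < 1"
    by (intro order_tendstoD(2)) auto
  then obtain n where "C * (b / a) ^ n < 1"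
    by (meson eventually_happens' sequentially_bot)
  hence "C * b ^ n < a ^ n"
    using a by (simp add: power_divide field_simps)
  thus False using assms(2)[of n] by simp
qed

lemma le_if_multiples_le:
  fixes a b C :: real
  assumes "\<And>n::nat. real n * a \<le> real n * b + C"
  shows "a \<le> b"
proof (rule ccontr)
  assume "\<not> a \<le> b"
  then obtain n where "C < real n * (a - b)"
    using ex_less_of_nat_mult[of "a - b" C] by auto
  thus False using assms[of n] by (simp add: algebra_simps)
qed

lemma fraction_between:
  fixes a b :: real
  assumes "a < b"
  obtains p q n :: nat where "n > 0" "a < (real p - real q) / real n" "(real p - real q) / real n < b"
proof -
  obtain r where r: "a < of_rat r" "of_rat r < b" using of_rat_dense[OF assms] by blast
  obtain i k where ik: "r = Fract i k" "k > 0" by (cases r) auto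
  have eq: "of_rat r = (real (nat i) - real (nat (- i))) / real (nat k)"
    using ik by (simp add: of_rat_rat of_nat_nat)
  show thesis using that[of "nat k" "nat i" "nat (- i)"] r ik unfolding eq by simp
qed

section \<open>Preordered semirings\<close>

locale preordered_semiring =
  fixes le :: "'a::comm_semiring_1 \<Rightarrow> 'a \<Rightarrow> bool" (infix "\<preceq>" 50)
  assumes preorder: "semiring_preorder (\<preceq>)"
    and zero_le_one: "0 \<preceq> 1"
begin

lemma refl [simp, intro]: "x \<preceq> x"
  using preorder by (auto simp: semiring_preorder_def reflp_def)

lemma trans [trans]: "x \<preceq> y \<Longrightarrow> y \<preceq> z \<Longrightarrow> x \<preceq> z"
  using preorder unfolding semiring_preorder_def transp_def by blast

lemma add_left: "x \<preceq> y \<Longrightarrow> a + x \<preceq> a + y"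
  and mult_left: "x \<preceq> y \<Longrightarrow> a * x \<preceq> a * y"
  using preorder by (auto simp: semiring_preorder_def)

lemma add_mono: "a \<preceq> b \<Longrightarrow> c \<preceq> d \<Longrightarrow> a + c \<preceq> b + d"
  using add_left[of c d a] add_left[of a b d] by (metis add.commute trans)

lemma mult_mono: "a \<preceq> b \<Longrightarrow> c \<preceq> d \<Longrightarrow> a * c \<preceq> b * d"
  using mult_left[of c d a] mult_left[of a b d] by (metis mult.commute trans)

lemma mult_right: "x \<preceq> y \<Longrightarrow> x * a \<preceq> y * a"
  by (simp add: mult_mono)

lemma power_mono: "a \<preceq> b \<Longrightarrow> a ^ n \<preceq> b ^ n"
  by (induction n) (auto intro: mult_mono)

lemma zero_le [simp]: "0 \<preceq> x"
  using mult_left[OF zero_le_one, of x] by simp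

lemma le_add1: "x \<preceq> x + y" and le_add2: "y \<preceq> x + y"
  using add_mono[OF refl zero_le, of x y] add_mono[OF zero_le refl, of y x] by simp_all

lemma add_multiples:
  assumes "a + e \<preceq> b + e"
  shows "of_nat n * a + e \<preceq> of_nat n * b + e"
proof (induction n)
  case (Suc n)
  have "of_nat (Suc n) * a + e = a + (of_nat n * a + e)" by (simp add: algebra_simps)
  also have "\<dots> \<preceq> a + (of_nat n * b + e)" by (rule add_left[OF Suc.IH])
  also have "\<dots> = of_nat n * b + (a + e)" by (simp add: algebra_simps)
  also have "\<dots> \<preceq> of_nat n * b + (b + e)" by (rule add_left[OF assms])
  also have "\<dots> = of_nat (Suc n) * b + e" by (simp add: algebra_simps)
  finally show ?case .
qed simp

lemma scaled_powers:
  assumes "c * a \<preceq> c * b"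
  shows "c * a ^ n \<preceq> c * b ^ n"
proof (induction n)
  case (Suc n)
  have "c * a ^ Suc n = a * (c * a ^ n)" by (simp add: algebra_simps)
  also have "\<dots> \<preceq> a * (c * b ^ n)" by (rule mult_left[OF Suc.IH])
  also have "\<dots> = b ^ n * (c * a)" by (simp add: algebra_simps)
  also have "\<dots> \<preceq> b ^ n * (c * b)" by (rule mult_left[OF assms])
  also have "\<dots> = c * b ^ Suc n" by (simp add: algebra_simps)
  finally show ?case .
qed simp

text \<open>
  This is the factorisation \<open>x\<^sup>n - y\<^sup>n = (x - y) * g\<close> of a difference of powers, multiplied with
  the difference form \<open>c (x - y) \<le> q - p\<close> of the assumption. It is stated so that neither
  subtraction nor additive cancellation is needed.
\<close>
lemma telescope:
  assumes "c * x + p \<preceq> c * y + q"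
  shows "c * x ^ n + p * (\<Sum>i<n. x ^ i * y ^ (n - Suc i)) \<preceq> c * y ^ n + q * (\<Sum>i<n. x ^ i * y ^ (n - Suc i))"
proof (induction n)
  case (Suc n)
  define s where "s = (\<Sum>i<n. x ^ i * y ^ (n - Suc i))"
  have s: "(\<Sum>i<Suc n. x ^ i * y ^ (Suc n - Suc i)) = y ^ n + x * s"
    unfolding s_def sum.lessThan_Suc_shift by (simp add: sum_distrib_left mult.assoc)
  have "c * x ^ Suc n + p * (y ^ n + x * s) = x * (c * x ^ n + p * s) + p * y ^ n"
    by (simp add: algebra_simps)
  also have "\<dots> \<preceq> x * (c * y ^ n + q * s) + p * y ^ n"
    by (rule add_mono[OF mult_left[OF Suc.IH[folded s_def]] refl])
  also have "\<dots> = y ^ n * (c * x + p) + q * x * s" by (simp add: algebra_simps)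
  also have "\<dots> \<preceq> y ^ n * (c * y + q) + q * x * s"
    by (rule add_mono[OF mult_left[OF assms] refl])
  also have "\<dots> = c * y ^ Suc n + q * (y ^ n + x * s)" by (simp add: algebra_simps)
  finally show ?case unfolding s .
qed simp

end

section \<open>Homomorphisms on a preordered semiring with two-sided growth bounds\<close>

text \<open>
  Real and tropical homomorphisms differ only in how they treat sums, so the theory of
  multiplicative monotone \<open>\<phi>\<close> is common to both. Power universality enters as growth bounds
  because these assert positive facts only, which hold at once for every larger preorder.
\<close>
locale growth_preorder = preordered_semiring le
  for le :: "'a::comm_semiring_1 \<Rightarrow> 'a \<Rightarrow> bool" (infix "\<preceq>" 50) +
  fixes u :: 'a and T :: "'a set" and \<phi> :: "'a \<Rightarrow> real"
  assumes subsemiring: "subsemiring T"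
    and u_in: "u \<in> T"
    and one_le_u: "1 \<preceq> u"
    and upper: "\<exists>k. x \<preceq> u ^ k"
    and lower: "x \<noteq> 0 \<Longrightarrow> \<exists>k. 1 \<preceq> x * u ^ k"
    and nonneg: "x \<in> T \<Longrightarrow> 0 \<le> \<phi> x"
    and phi_0: "\<phi> 0 = 0" and phi_1: "\<phi> 1 = 1"
    and phi_mult: "x \<in> T \<Longrightarrow> y \<in> T \<Longrightarrow> \<phi> (x * y) = \<phi> x * \<phi> y"
    and phi_mono: "x \<in> T \<Longrightarrow> y \<in> T \<Longrightarrow> x \<preceq> y \<Longrightarrow> \<phi> x \<le> \<phi> y"
begin

lemma T_0: "0 \<in> T" and T_1: "1 \<in> T"
  and T_add: "x \<in> T \<Longrightarrow> y \<in> T \<Longrightarrow> x + y \<in> T"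
  and T_mult: "x \<in> T \<Longrightarrow> y \<in> T \<Longrightarrow> x * y \<in> T"
  using subsemiring by (auto simp: subsemiring_def)

lemma T_power: "x \<in> T \<Longrightarrow> x ^ n \<in> T"
  by (induction n) (auto intro: T_1 T_mult)

lemma T_of_nat: "of_nat n \<in> T"
  by (induction n) (auto intro: T_0 T_1 T_add)

lemma T_sum: "(\<And>i. i \<in> A \<Longrightarrow> f i \<in> T) \<Longrightarrow> sum f A \<in> T"
  by (induction A rule: infinite_finite_induct) (auto intro: T_0 T_add)

lemmas T_closed = T_0 T_1 T_add T_mult T_power T_of_nat T_sum u_in

lemma phi_power: "x \<in> T \<Longrightarrow> \<phi> (x ^ n) = \<phi> x ^ n"
  by (induction n) (auto simp: phi_1 phi_mult T_power)

lemma phi_u: "1 \<le> \<phi> u"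
  using phi_mono[OF T_1 u_in one_le_u] phi_1 by simp

lemma not_one_le_zero: "\<not> 1 \<preceq> 0"
  using phi_mono[of 1 0] by (auto simp: T_closed phi_0 phi_1)

lemma not_le_zero: "x \<noteq> 0 \<Longrightarrow> \<not> x \<preceq> 0"
  using lower[of x] not_one_le_zero mult_right trans by (metis mult_zero_left)

lemma mult_nonzero:
  fixes x y :: 'a
  shows "x \<noteq> 0 \<Longrightarrow> y \<noteq> 0 \<Longrightarrow> x * y \<noteq> 0"
proof
  assume "x \<noteq> 0" "y \<noteq> 0" "x * y = 0"
  obtain k where "1 \<preceq> x * u ^ k" using lower \<open>x \<noteq> 0\<close> by blast
  hence "y \<preceq> 0" using mult_left[of 1 "x * u ^ k" y] \<open>x * y = 0\<close>
    by (simp add: mult.left_commute mult.assoc[symmetric] mult.commute[of y x])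
  thus False using not_le_zero \<open>y \<noteq> 0\<close> by blast
qed

lemma power_nonzero: "(x::'a) \<noteq> 0 \<Longrightarrow> x ^ n \<noteq> 0"
  by (induction n) (auto dest: mult_nonzero)

lemma add_nonzero: "(x::'a) \<noteq> 0 \<Longrightarrow> x + y \<noteq> 0"
  using le_add1[of x y] not_le_zero by metis

lemma phi_pos: 
  assumes "x \<in> T" "x \<noteq> 0" shows "0 < \<phi> x"
proof -
  obtain k where "1 \<preceq> x * u ^ k" using lower assms by blast
  hence "\<phi> 1 \<le> \<phi> (x * u ^ k)" by (intro phi_mono T_closed assms)
  hence "1 \<le> \<phi> x * \<phi> u ^ k" by (simp add: phi_mult phi_power phi_1 T_closed assms)
  thus ?thesis using nonneg[OF assms(1)] by (cases "\<phi> x = 0") auto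
qed

lemma comparable_up_to_u:
  assumes "c \<noteq> 0" obtains k where "w \<preceq> c * u ^ k"
proof -
  obtain k where k: "1 \<preceq> c * u ^ k" using lower assms by blast
  obtain l where l: "w \<preceq> u ^ l" using upper by blast
  have "w * 1 \<preceq> u ^ l * (c * u ^ k)" by (intro mult_mono k l)
  thus ?thesis using that[of "l + k"] by (simp add: power_add mult.left_commute)
qed

end

text \<open>
  Since \<open>0 \<le> 1\<close>, the element \<open>1 + x\<close> lies above both \<open>1\<close> and \<open>x\<close>, so power universality applies
  to the pairs \<open>1 \<le> 1 + x\<close> and \<open>x \<le> 1 + x\<close> even when \<open>1\<close> and \<open>x\<close> are incomparable. It needs
  \<open>1 + x\<close> to be nonzero, which holds because otherwise \<open>1 \<le> 0\<close> and \<open>\<phi> 1 \<le> \<phi> 0\<close>.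
\<close>
lemma growth_preorder_if_power_universal:
  assumes le: "semiring_preorder le" "le 0 1" and u: "power_universal le u"
    and T: "subsemiring T" "u \<in> T" and \<phi>: "monotone_hom_wrt add le T \<phi>"
  shows "growth_preorder le u T \<phi>"
proof -
  interpret preordered_semiring le by unfold_locales (fact le)+
  have mono: "\<phi> x \<le> \<phi> y" if "x \<in> T" "y \<in> T" "le x y" for x y
    using \<phi> that by (auto simp: monotone_hom_wrt_def monotone_on_def)
  have "0 \<in> T" "1 \<in> T" "\<phi> 0 = 0" "\<phi> 1 = 1" 
    using T \<phi> by (auto simp: subsemiring_def monotone_hom_wrt_def)
  hence "\<not> le 1 0" using mono[of 1 0] by auto
  hence one_add: "1 + x \<noteq> 0" for x :: 'a using le_add1[of 1 x] by metis
  have univ: "\<exists>k. le y (x * u ^ k)" if "x \<noteq> 0" "y \<noteq> 0" "le x y" for x y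
    using u that by (auto simp: power_universal_def)
  show ?thesis
  proof
    show "\<exists>k. le x (u ^ k)" for x
    proof -
      obtain k where "le (1 + x) (1 * u ^ k)" using univ[OF _ one_add le_add1] by auto
      thus ?thesis using le_add2[of x 1] trans by auto
    qed
    show "\<exists>k. le 1 (x * u ^ k)" if "x \<noteq> 0" for x
      using univ[OF that one_add le_add2] le_add1[of 1 x] trans by blast
  qed (use T u \<phi> mono in \<open>auto simp: power_universal_def monotone_hom_wrt_def\<close>)
qed

section \<open>Maximal preorders with monotone \<open>\<phi>\<close>\<close>

text \<open>
  Maximality is stated as a proof principle: to derive \<open>x \<preceq> y\<close>, exhibit any semiring preorder
  above \<open>\<preceq>\<close> that relates \<open>x\<close> to \<open>y\<close> and leaves \<open>\<phi>\<close> monotone on \<open>T\<close>.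
\<close>
locale maximal_growth_preorder = growth_preorder le u T \<phi>
  for le :: "'a::comm_semiring_1 \<Rightarrow> 'a \<Rightarrow> bool" (infix "\<preceq>" 50) and u T \<phi> +
  assumes maximal: "semiring_preorder r \<Longrightarrow> (\<And>x y. x \<preceq> y \<Longrightarrow> r x y) \<Longrightarrow>
    (\<And>x y. x \<in> T \<Longrightarrow> y \<in> T \<Longrightarrow> r x y \<Longrightarrow> \<phi> x \<le> \<phi> y) \<Longrightarrow> r x y \<Longrightarrow> x \<preceq> y"
begin

text \<open>
  From \<open>c x \<preceq> c y\<close> one gets \<open>c x\<^sup>n \<preceq> c y\<^sup>n\<close> for all \<open>n\<close> with the same \<open>c\<close>. If \<open>x\<close> and \<open>y\<close> are in
  \<open>T\<close>, bounding \<open>c\<close> by powers of \<open>u\<close> leaves a constant factor independent of \<open>n\<close>, so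
  \<open>\<phi> x \<le> \<phi> y\<close>.
\<close>
lemma mult_cancel:
  assumes "c * x \<preceq> c * y" and "c \<noteq> 0"
  shows "x \<preceq> y"
proof (rule maximal[of "\<lambda>x y. \<exists>c. c \<noteq> 0 \<and> c * x \<preceq> c * y"])
  let ?r = "\<lambda>x y. \<exists>c. c \<noteq> 0 \<and> c * x \<preceq> c * y"
  show "?r x y" using assms by blast
  show "?r x y" if "x \<preceq> y" for x y
    using that by (intro exI[of _ 1]) simp
  show "semiring_preorder ?r"
    unfolding semiring_preorder_def
  proof (intro conjI allI impI)
    show "reflp ?r" by (rule reflpI) (auto intro: exI[of _ 1])
    show "transp ?r"
    proof (rule transpI)
      fix x y z assume "?r x y" "?r y z"
      then obtain c d where c: "c \<noteq> 0" "c * x \<preceq> c * y" and d: "d \<noteq> 0" "d * y \<preceq> d * z" by blast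
      have "c * d * x = d * (c * x)" by (simp add: mult_ac)
      also have "\<dots> \<preceq> d * (c * y)" by (rule mult_left[OF c(2)])
      also have "\<dots> = c * (d * y)" by (simp add: mult_ac)
      also have "\<dots> \<preceq> c * (d * z)" by (rule mult_left[OF d(2)])
      finally show "?r x z" using mult_nonzero[OF c(1) d(1)] by (auto simp: mult_ac)
    qed
    fix a x y assume "?r x y"
    then obtain c where c: "c \<noteq> 0" "c * x \<preceq> c * y" by blast
    show "?r (a + x) (a + y)"
      using c add_left[OF c(2), of "c * a"] by (auto simp: distrib_left)
    show "?r (a * x) (a * y)"
      using c mult_left[OF c(2), of a] by (auto simp: mult.left_commute)
  qed
  fix x y assume xy: "x \<in> T" "y \<in> T" and "?r x y"
  then obtain c where c: "c \<noteq> 0" "c * x \<preceq> c * y" by blast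
  obtain k where k: "1 \<preceq> c * u ^ k" using lower[OF c(1)] by blast
  obtain l where l: "c \<preceq> u ^ l" using upper by blast
  show "\<phi> x \<le> \<phi> y"
  proof (rule le_if_powers_le)
    fix n
    have "x ^ n = x ^ n * 1" by simp
    also have "\<dots> \<preceq> x ^ n * (c * u ^ k)" by (rule mult_left[OF k])
    also have "\<dots> = u ^ k * (c * x ^ n)" by (simp add: mult_ac)
    also have "\<dots> \<preceq> u ^ k * (c * y ^ n)" by (intro mult_left scaled_powers c)
    also have "\<dots> \<preceq> u ^ k * (u ^ l * y ^ n)" by (intro mult_left mult_right l)
    also have "\<dots> = u ^ (k + l) * y ^ n" by (simp add: power_add mult_ac)
    finally have "\<phi> (x ^ n) \<le> \<phi> (u ^ (k + l) * y ^ n)" by (intro phi_mono T_closed xy)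
    thus "\<phi> x ^ n \<le> \<phi> u ^ (k + l) * \<phi> y ^ n" by (simp add: phi_mult phi_power T_closed xy)
  qed (use nonneg xy in auto)
qed

end

lemma (in growth_preorder) maximal_extension:
  obtains r where "\<And>x y. x \<preceq> y \<Longrightarrow> r x y" "maximal_growth_preorder r u T \<phi>"
proof -
  define \<A> where "\<A> = {R. semiring_preorder (\<lambda>x y. (x, y) \<in> R) \<and> {(x, y). x \<preceq> y} \<subseteq> R \<and>
    (\<forall>x\<in>T. \<forall>y\<in>T. (x, y) \<in> R \<longrightarrow> \<phi> x \<le> \<phi> y)}"
  have "\<exists>M\<in>\<A>. \<forall>X\<in>\<A>. M \<subseteq> X \<longrightarrow> X = M"
  proof (rule subset_Zorn_nonempty)
    have "{(x, y). x \<preceq> y} \<in> \<A>" using preorder phi_mono by (auto simp: \<A>_def)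
    thus "\<A> \<noteq> {}" by blast
    fix C assume C: "C \<noteq> {}" "subset.chain \<A> C"
    hence CA: "C \<subseteq> \<A>" and lin: "\<And>X Y. X \<in> C \<Longrightarrow> Y \<in> C \<Longrightarrow> X \<subseteq> Y \<or> Y \<subseteq> X"
      by (auto simp: subset_chain_def)
    obtain X0 where X0: "X0 \<in> C" using C(1) by blast
    have mem: "reflp (\<lambda>x y. (x, y) \<in> X)" "transp (\<lambda>x y. (x, y) \<in> X)"
      "\<And>a x y. (x, y) \<in> X \<Longrightarrow> (a + x, a + y) \<in> X \<and> (a * x, a * y) \<in> X"
      "{(x, y). x \<preceq> y} \<subseteq> X" "\<And>x y. x \<in> T \<Longrightarrow> y \<in> T \<Longrightarrow> (x, y) \<in> X \<Longrightarrow> \<phi> x \<le> \<phi> y"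
      if "X \<in> C" for X
      using that CA by (auto simp: \<A>_def semiring_preorder_def)
    have "semiring_preorder (\<lambda>x y. (x, y) \<in> \<Union>C)"
      unfolding semiring_preorder_def
    proof (intro conjI allI impI)
      show "reflp (\<lambda>x y. (x, y) \<in> \<Union>C)"
        using mem(1)[OF X0] X0 unfolding reflp_def by blast
      show "transp (\<lambda>x y. (x, y) \<in> \<Union>C)"
      proof (rule transpI)
        fix x y z assume "(x, y) \<in> \<Union>C" "(y, z) \<in> \<Union>C"
        then obtain X Y where XY: "X \<in> C" "Y \<in> C" "(x, y) \<in> X" "(y, z) \<in> Y" by blast
        then obtain Z where "Z \<in> C" "(x, y) \<in> Z" "(y, z) \<in> Z" using lin[of X Y] by blast
        thus "(x, z) \<in> \<Union>C" using mem(2)[of Z] unfolding transp_def by blast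
      qed
    qed (use mem(3) in blast)+
    moreover have "{(x, y). x \<preceq> y} \<subseteq> \<Union>C" using mem(4)[OF X0] X0 by blast
    ultimately show "\<Union>C \<in> \<A>" using mem(5) by (auto simp: \<A>_def)
  qed
  then obtain M where M: "M \<in> \<A>" and max: "\<And>X. X \<in> \<A> \<Longrightarrow> M \<subseteq> X \<Longrightarrow> X = M" by blast
  let ?r = "\<lambda>x y. (x, y) \<in> M"
  have ext: "?r x y" if "x \<preceq> y" for x y using M that by (auto simp: \<A>_def)
  have "maximal_growth_preorder ?r u T \<phi>"
  proof
    show "semiring_preorder ?r" using M by (simp add: \<A>_def)
    show "?r 0 1" "?r 1 u" by (rule ext[OF zero_le_one], rule ext[OF one_le_u])
    show "subsemiring T" "u \<in> T" by (rule subsemiring, rule u_in)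
    show "\<exists>k. ?r x (u ^ k)" for x using upper ext by blast
    show "\<exists>k. ?r 1 (x * u ^ k)" if "x \<noteq> 0" for x using lower that ext by blast
    show "\<phi> x \<le> \<phi> y" if "x \<in> T" "y \<in> T" "?r x y" for x y
      using M that by (auto simp: \<A>_def)
    fix r x y
    assume r: "semiring_preorder r" "\<And>x y. ?r x y \<Longrightarrow> r x y"
      "\<And>x y. x \<in> T \<Longrightarrow> y \<in> T \<Longrightarrow> r x y \<Longrightarrow> \<phi> x \<le> \<phi> y" "r x y"
    have "{(x, y). r x y} = M"
      using r ext by (intro max) (auto simp: \<A>_def)
    thus "?r x y" using r(4) by blast
  qed (use nonneg phi_0 phi_1 phi_mult in auto)
  with ext show thesis by (rule that)
qed

section \<open>The multiplicative extension for a total preorder\<close>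

text \<open>
  If \<open>\<phi> u > 1\<close>, the set \<open>D x\<close> collects the rational exponents \<open>r\<close> for which formally
  \<open>u\<^sup>r \<preceq> x\<close>, written without roots and inverses. By totality any other exponent satisfies
  the opposite inequality, so \<open>Sup (D x)\<close> is also an infimum, and it is additive in \<open>x\<close>.
  If \<open>\<phi> u = 1\<close>, the growth bounds force \<open>\<phi>\<close> to be \<open>1\<close> on all nonzero elements.
\<close>
lemma (in growth_preorder) multiplicative_extension:
  assumes total: "\<And>x y. x \<preceq> y \<or> y \<preceq> x"
  obtains \<psi> where "\<And>x. 0 \<le> \<psi> x" "\<And>x y. \<psi> (x * y) = \<psi> x * \<psi> y"
    "\<And>x y. x \<preceq> y \<Longrightarrow> \<psi> x \<le> \<psi> y" "\<And>x. x \<in> T \<Longrightarrow> \<psi> x = \<phi> x"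
proof (cases "\<phi> u = 1")
  case True
  have "\<phi> x = 1" if x: "x \<in> T" "x \<noteq> 0" for x
  proof (rule antisym)
    obtain k where "x \<preceq> u ^ k" using upper by blast
    hence "\<phi> x \<le> \<phi> (u ^ k)" by (intro phi_mono T_closed x)
    thus "\<phi> x \<le> 1" by (simp add: phi_power True u_in)
    obtain k where "1 \<preceq> x * u ^ k" using lower x by blast
    hence "\<phi> 1 \<le> \<phi> (x * u ^ k)" by (intro phi_mono T_closed x)
    thus "1 \<le> \<phi> x" by (simp add: phi_power phi_mult phi_1 True T_closed x)
  qed
  thus ?thesis
    by (intro that[of "\<lambda>x. if x = 0 then 0 else 1"])
      (use mult_nonzero not_le_zero phi_0 in auto)
next
  case False
  hence U: "1 < \<phi> u" using phi_u by simp
  have u_exp: "i \<le> j" if "u ^ i \<preceq> u ^ j" for i j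
    using phi_mono[OF _ _ that] U by (auto simp: phi_power T_closed)
  define D where "D x = {(real p - real q) / real n | p q n. n > 0 \<and> u ^ p \<preceq> u ^ q * x ^ n}" for x
  have upperD: "r \<le> (real p - real q) / real n"
    if r: "r \<in> D x" and n: "n > 0" and le: "u ^ q * x ^ n \<preceq> u ^ p" for r x p q n
  proof -
    obtain p' q' n' where r': "r = (real p' - real q') / real n'" "n' > 0" "u ^ p' \<preceq> u ^ q' * x ^ n'"
      using r by (auto simp: D_def)
    have "u ^ (p' * n + q * n') = (u ^ p') ^ n * (u ^ q) ^ n'"
      by (simp add: power_add power_mult)
    also have "\<dots> \<preceq> (u ^ q' * x ^ n') ^ n * (u ^ q) ^ n'"
      by (intro mult_right power_mono r')
    also have "\<dots> = (u ^ q') ^ n * (u ^ q * x ^ n) ^ n'"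
      by (simp add: power_mult_distrib power_mult[symmetric] mult_ac)
    also have "\<dots> \<preceq> (u ^ q') ^ n * (u ^ p) ^ n'"
      by (intro mult_left power_mono le)
    also have "\<dots> = u ^ (q' * n + p * n')" by (simp add: power_add power_mult)
    finally have "p' * n + q * n' \<le> q' * n + p * n'" by (rule u_exp)
    hence "real p' * real n + real q * real n' \<le> real q' * real n + real p * real n'"
      by (simp flip: of_nat_mult of_nat_add)
    thus ?thesis using n r'(2) unfolding r'(1) by (simp add: field_simps)
  qed
  have D_nonempty: "D x \<noteq> {}" if x: "x \<noteq> 0" for x
  proof -
    obtain k where "1 \<preceq> x * u ^ k" using lower[OF x] by blast
    hence "(real 0 - real k) / real 1 \<in> D x" 
      unfolding D_def by (intro CollectI exI[of _ 0] exI[of _ k] exI[of _ 1]) (auto simp: mult.commute)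
    thus ?thesis by blast
  qed
  have D_bdd: "bdd_above (D x)" for x
  proof -
    obtain k where "x \<preceq> u ^ k" using upper by blast
    thus ?thesis using upperD[of _ x 1 0 k] by (intro bdd_aboveI[of _ "real k"]) auto
  qed
  define L where "L x = Sup (D x)" for x
  have L_lower: "(real p - real q) / real n \<le> L x" if "n > 0" "u ^ p \<preceq> u ^ q * x ^ n" for p q n x
    unfolding L_def by (rule cSup_upper[OF _ D_bdd]) (use that in \<open>auto simp: D_def\<close>)
  have L_upper: "L x \<le> (real p - real q) / real n" if "x \<noteq> 0" "n > 0" "u ^ q * x ^ n \<preceq> u ^ p" for p q n x
    unfolding L_def by (rule cSup_least[OF D_nonempty]) (use that upperD in auto)
  have L_mult: "L (x * y) = L x + L y" if x: "x \<noteq> 0" and y: "y \<noteq> 0" for x y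
  proof (rule antisym; rule ccontr)
    assume "\<not> L (x * y) \<le> L x + L y"
    hence *: "L x < L (x * y) - L y" by simp
    obtain p q n where 1: "n > 0" "L x < (real p - real q) / real n" "(real p - real q) / real n < L (x * y) - L y"
      by (rule fraction_between[OF *])
    hence *: "L y < L (x * y) - (real p - real q) / real n" by simp
    obtain p' q' n' where 2: "n' > 0" "L y < (real p' - real q') / real n'" 
      "(real p' - real q') / real n' < L (x * y) - (real p - real q) / real n"
      by (rule fraction_between[OF *])
    have "u ^ q * x ^ n \<preceq> u ^ p" "u ^ q' * y ^ n' \<preceq> u ^ p'"
      using total L_lower 1 2 by (meson not_le)+
    hence "(u ^ q * x ^ n) ^ n' * (u ^ q' * y ^ n') ^ n \<preceq> (u ^ p) ^ n' * (u ^ p') ^ n"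
      by (intro mult_mono power_mono)
    hence "u ^ (q * n' + q' * n) * (x * y) ^ (n * n') \<preceq> u ^ (p * n' + p' * n)"
      by (simp add: power_mult_distrib power_add mult_ac flip: power_mult)
    hence "L (x * y) \<le> (real (p * n' + p' * n) - real (q * n' + q' * n)) / real (n * n')"
      using 1(1) 2(1) mult_nonzero[OF x y] by (intro L_upper) auto
    also have "\<dots> = (real p - real q) / real n + (real p' - real q') / real n'"
      using 1(1) 2(1) by (simp add: field_simps)
    finally show False using 2(3) by simp
  next
    assume "\<not> L x + L y \<le> L (x * y)"
    hence *: "L (x * y) - L y < L x" by simp
    obtain p q n where 1: "n > 0" "L (x * y) - L y < (real p - real q) / real n" "(real p - real q) / real n < L x"
      by (rule fraction_between[OF *])
    hence *: "L (x * y) - (real p - real q) / real n < L y" by simp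
    obtain p' q' n' where 2: "n' > 0" "L (x * y) - (real p - real q) / real n < (real p' - real q') / real n'" 
      "(real p' - real q') / real n' < L y"
      by (rule fraction_between[OF *])
    have "u ^ p \<preceq> u ^ q * x ^ n" "u ^ p' \<preceq> u ^ q' * y ^ n'"
      using total L_upper[OF x] L_upper[OF y] 1 2 by (meson not_le)+
    hence "(u ^ p) ^ n' * (u ^ p') ^ n \<preceq> (u ^ q * x ^ n) ^ n' * (u ^ q' * y ^ n') ^ n"
      by (intro mult_mono power_mono)
    hence "u ^ (p * n' + p' * n) \<preceq> u ^ (q * n' + q' * n) * (x * y) ^ (n * n')"
      by (simp add: power_mult_distrib power_add mult_ac flip: power_mult)
    hence "(real (p * n' + p' * n) - real (q * n' + q' * n)) / real (n * n') \<le> L (x * y)"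
      using 1(1) 2(1) by (intro L_lower) auto
    also have "(real (p * n' + p' * n) - real (q * n' + q' * n)) / real (n * n')
      = (real p - real q) / real n + (real p' - real q') / real n'"
      using 1(1) 2(1) by (simp add: field_simps)
    finally show False using 2(2) by simp
  qed
  have L_mono: "L x \<le> L y" if x: "x \<noteq> 0" and le: "x \<preceq> y" for x y
    unfolding L_def
  proof (rule cSup_subset_mono[OF D_nonempty[OF x] D_bdd])
    show "D x \<subseteq> D y"
      using power_mono[OF le] mult_left trans unfolding D_def by blast
  qed
  have L_T: "\<phi> u powr L x = \<phi> x" if x: "x \<in> T" "x \<noteq> 0" for x
  proof -
    have pos: "0 < \<phi> x" by (rule phi_pos[OF x])
    define l where "l = log (\<phi> u) (\<phi> x)"
    have log_pow: "log (\<phi> u) (\<phi> (u ^ q * x ^ n)) = real q + real n * l" for q n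
      using U pos x by (simp add: phi_mult phi_power T_closed log_mult log_nat_power l_def)
    have log_u: "log (\<phi> u) (\<phi> (u ^ p)) = real p" for p
      using U by (simp add: phi_power u_in log_nat_power)
    have val_pos: "0 < \<phi> (u ^ q * x ^ n)" "0 < \<phi> (u ^ p)" for p q n
      using U pos x by (auto simp: phi_mult phi_power T_closed)
    have "L x = l"
    proof (rule antisym; rule ccontr)
      assume "\<not> L x \<le> l"
      hence *: "l < L x" by simp
      obtain p q n where 1: "n > 0" "l < (real p - real q) / real n" "(real p - real q) / real n < L x"
        by (rule fraction_between[OF *])
      have "u ^ p \<preceq> u ^ q * x ^ n" using total L_upper[OF x(2)] 1 by (meson not_le)
      hence "\<phi> (u ^ p) \<le> \<phi> (u ^ q * x ^ n)" by (intro phi_mono T_closed x)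
      hence "log (\<phi> u) (\<phi> (u ^ p)) \<le> log (\<phi> u) (\<phi> (u ^ q * x ^ n))"
        using U val_pos by simp
      thus False using 1 unfolding log_u log_pow by (simp add: field_simps)
    next
      assume "\<not> l \<le> L x"
      hence *: "L x < l" by simp
      obtain p q n where 1: "n > 0" "L x < (real p - real q) / real n" "(real p - real q) / real n < l"
        by (rule fraction_between[OF *])
      have "u ^ q * x ^ n \<preceq> u ^ p" using total L_lower 1 by (meson not_le)
      hence "\<phi> (u ^ q * x ^ n) \<le> \<phi> (u ^ p)" by (intro phi_mono T_closed x)
      hence "log (\<phi> u) (\<phi> (u ^ q * x ^ n)) \<le> log (\<phi> u) (\<phi> (u ^ p))"
        using U val_pos by simp
      thus False using 1 unfolding log_u log_pow by (simp add: field_simps)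
    qed
    thus ?thesis using U pos by (simp add: l_def)
  qed
  show ?thesis
  proof (rule that[of "\<lambda>x. if x = 0 then 0 else \<phi> u powr L x"])
    show "(if x * y = 0 then 0 else \<phi> u powr L (x * y)) =
        (if x = 0 then 0 else \<phi> u powr L x) * (if y = 0 then 0 else \<phi> u powr L y)" for x y
      using mult_nonzero[of x y] L_mult[of x y] by (auto simp: powr_add)
    show "(if x = 0 then 0 else \<phi> u powr L x) \<le> (if y = 0 then 0 else \<phi> u powr L y)"
      if "x \<preceq> y" for x y
      using that not_le_zero[of x] L_mono[of x y] U by auto
  qed (use L_T phi_0 in auto)
qed

section \<open>Totality and extension in the real case\<close>

locale maximal_real = maximal_growth_preorder +
  assumes phi_add: "x \<in> T \<Longrightarrow> y \<in> T \<Longrightarrow> \<phi> (x + y) = \<phi> x + \<phi> y"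
begin

lemma phi_of_nat: "\<phi> (of_nat n) = real n"
  by (induction n) (auto simp: phi_0 phi_1 phi_add T_closed)

text \<open>
  Additive cancellation is consistent with \<open>\<phi>\<close>: from \<open>x + e \<preceq> y + e\<close> one gets
  \<open>n x \<preceq> n y + e\<close> for all \<open>n\<close>, and \<open>e\<close> contributes at most a fixed power of \<open>\<phi> u\<close>.
\<close>
lemma add_cancel:
  assumes "x + e \<preceq> y + e"
  shows "x \<preceq> y"
proof (rule maximal[of "\<lambda>x y. \<exists>e. x + e \<preceq> y + e"])
  let ?r = "\<lambda>x y. \<exists>e. x + e \<preceq> y + e"
  show "?r x y" using assms by blast
  show "?r x y" if "x \<preceq> y" for x y
    using that by (intro exI[of _ 0]) simp
  show "semiring_preorder ?r"
    unfolding semiring_preorder_def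
  proof (intro conjI allI impI)
    show "reflp ?r" by (rule reflpI) auto
    show "transp ?r"
    proof (rule transpI)
      fix x y z assume "?r x y" "?r y z"
      then obtain e f where ef: "x + e \<preceq> y + e" "y + f \<preceq> z + f" by blast
      have "x + (e + f) = f + (x + e)" by (simp add: add_ac)
      also have "\<dots> \<preceq> f + (y + e)" by (rule add_left[OF ef(1)])
      also have "\<dots> = e + (y + f)" by (simp add: add_ac)
      also have "\<dots> \<preceq> e + (z + f)" by (rule add_left[OF ef(2)])
      also have "\<dots> = z + (e + f)" by (simp add: add_ac)
      finally show "?r x z" by blast
    qed
    fix a x y assume "?r x y"
    then obtain e where e: "x + e \<preceq> y + e" by blast
    show "?r (a + x) (a + y)"
      using add_left[OF e, of a] by (auto simp: add.assoc)
    show "?r (a * x) (a * y)"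
      using mult_left[OF e, of a] by (auto simp: distrib_left)
  qed
  fix x y assume xy: "x \<in> T" "y \<in> T" and "?r x y"
  then obtain e where e: "x + e \<preceq> y + e" by blast
  obtain k where k: "e \<preceq> u ^ k" using upper by blast
  show "\<phi> x \<le> \<phi> y"
  proof (rule le_if_multiples_le)
    fix n
    have "of_nat n * x \<preceq> of_nat n * x + e" by (rule le_add1)
    also have "\<dots> \<preceq> of_nat n * y + e" by (rule add_multiples[OF e])
    also have "\<dots> \<preceq> of_nat n * y + u ^ k" by (rule add_left[OF k])
    finally have "\<phi> (of_nat n * x) \<le> \<phi> (of_nat n * y + u ^ k)" by (intro phi_mono T_closed xy)
    thus "real n * \<phi> x \<le> real n * \<phi> y + \<phi> u ^ k"
      by (simp add: phi_mult phi_add phi_power phi_of_nat T_closed xy)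
  qed
qed

text \<open>
  The weights \<open>c\<close> and \<open>w\<close> are arbitrary elements of the semiring, while \<open>\<phi>\<close> can only be applied
  inside \<open>T\<close>. Telescoping replaces \<open>a\<close> and \<open>b\<close> by their \<open>n\<close>-th powers while keeping the weights,
  and the weights differ only by bounded powers of \<open>u\<close>. After cancelling \<open>w\<close> the inequality
  lies in \<open>T\<close>, and applying \<open>\<phi>\<close> gives \<open>\<phi> a ^ n \<le> C * \<phi> b ^ n\<close> with \<open>C\<close> independent of \<open>n\<close>.
\<close>
lemma weighted_comparison:
  assumes T: "a \<in> T" "b \<in> T" "s \<in> T" "t \<in> T"
    and cw: "c \<noteq> 0" "w \<noteq> 0"
    and le: "c * a + w * t \<preceq> c * b + w * s"
    and st: "\<phi> s \<le> \<phi> t"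
  shows "\<phi> a \<le> \<phi> b"
proof -
  obtain k where k: "w \<preceq> c * u ^ k" by (rule comparable_up_to_u[OF cw(1)])
  obtain l where l: "c \<preceq> w * u ^ l" by (rule comparable_up_to_u[OF cw(2)])
  show ?thesis
  proof (rule le_if_powers_le)
    fix n
    define g where "g = (\<Sum>i<n. a ^ i * b ^ (n - Suc i))"
    have g: "g \<in> T" unfolding g_def by (intro T_closed T)
    have "w * (a ^ n + u ^ k * t * g) = w * a ^ n + u ^ k * (w * t * g)"
      by (simp add: algebra_simps)
    also have "\<dots> \<preceq> c * u ^ k * a ^ n + u ^ k * (w * t * g)"
      by (intro add_mono mult_right k refl)
    also have "\<dots> = u ^ k * (c * a ^ n + w * t * g)" by (simp add: algebra_simps)
    also have "\<dots> \<preceq> u ^ k * (c * b ^ n + w * s * g)"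
      unfolding g_def by (intro mult_left telescope le)
    also have "\<dots> \<preceq> u ^ k * (w * u ^ l * b ^ n + w * s * g)"
      by (intro mult_left add_mono mult_right l refl)
    also have "\<dots> = w * (u ^ (k + l) * b ^ n + u ^ k * s * g)"
      by (simp add: algebra_simps power_add)
    finally have "a ^ n + u ^ k * t * g \<preceq> u ^ (k + l) * b ^ n + u ^ k * s * g"
      by (rule mult_cancel[OF _ cw(2)])
    hence "\<phi> (a ^ n + u ^ k * t * g) \<le> \<phi> (u ^ (k + l) * b ^ n + u ^ k * s * g)"
      by (intro phi_mono T_closed T g)
    hence "\<phi> a ^ n + \<phi> u ^ k * \<phi> t * \<phi> g \<le> \<phi> u ^ (k + l) * \<phi> b ^ n + \<phi> u ^ k * \<phi> s * \<phi> g"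
      by (simp add: phi_mult phi_add phi_power T_closed T g)
    moreover have "\<phi> u ^ k * \<phi> s * \<phi> g \<le> \<phi> u ^ k * \<phi> t * \<phi> g"
      using nonneg[OF g] nonneg[OF u_in] st by (intro mult_right_mono mult_left_mono) auto
    ultimately show "\<phi> a ^ n \<le> \<phi> u ^ (k + l) * \<phi> b ^ n" by linarith
  qed (use nonneg T in auto)
qed

text \<open>
  The relation \<open>\<exists>c w. c \<noteq> 0 \<and> c * a + w * x \<preceq> c * b + w * y\<close> is the preorder obtained by
  additionally forcing \<open>y \<preceq> x\<close>. By maximality it must break the monotonicity of \<open>\<phi>\<close>. The new
  inequality is really used, that is \<open>w \<noteq> 0\<close>, since otherwise \<open>c\<close> could be cancelled.
\<close>
lemma obstruction:
  assumes "\<not> y \<preceq> x"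
  obtains a b c w where "a \<in> T" "b \<in> T" "c \<noteq> 0" "w \<noteq> 0" "c * a + w * x \<preceq> c * b + w * y" "\<phi> b < \<phi> a"
proof -
  let ?r = "\<lambda>a b. \<exists>c w. c \<noteq> 0 \<and> c * a + w * x \<preceq> c * b + w * y"
  have "\<exists>a b. a \<in> T \<and> b \<in> T \<and> ?r a b \<and> \<not> \<phi> a \<le> \<phi> b"
  proof (rule ccontr)
    assume contra: "\<not> ?thesis"
    have "y \<preceq> x"
    proof (rule maximal[of ?r])
      show "?r y x" by (rule exI[of _ 1], rule exI[of _ 1]) (simp add: add.commute)
      show "?r a b" if "a \<preceq> b" for a b
        using that by (intro exI[of _ 1] exI[of _ 0]) simp
      show "\<phi> a \<le> \<phi> b" if "a \<in> T" "b \<in> T" "?r a b" for a b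
        using contra that by blast
      show "semiring_preorder ?r"
        unfolding semiring_preorder_def
      proof (intro conjI allI impI)
        show "reflp ?r" by (rule reflpI) (intro exI[of _ 1] exI[of _ 0], simp)
        show "transp ?r"
        proof (rule transpI)
          fix p q r assume "?r p q" "?r q r"
          then obtain c w d v where c: "c \<noteq> 0" "c * p + w * x \<preceq> c * q + w * y"
            and d: "d \<noteq> 0" "d * q + v * x \<preceq> d * r + v * y" by blast
          have "c * d * p + (d * w + c * v) * x + c * d * q
              = d * (c * p + w * x) + c * (d * q + v * x)" by (simp add: algebra_simps)
          also have "\<dots> \<preceq> d * (c * q + w * y) + c * (d * r + v * y)"
            by (intro add_mono mult_left c d)
          also have "\<dots> = c * d * r + (d * w + c * v) * y + c * d * q"
            by (simp add: algebra_simps)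
          finally have "c * d * p + (d * w + c * v) * x \<preceq> c * d * r + (d * w + c * v) * y"
            by (rule add_cancel)
          thus "?r p r" using mult_nonzero[OF c(1) d(1)] by blast
        qed
        fix e a b assume "?r a b"
        then obtain c w where c: "c \<noteq> 0" "c * a + w * x \<preceq> c * b + w * y" by blast
        show "?r (e + a) (e + b)"
          using c(1) add_left[OF c(2), of "c * e"] by (auto simp: distrib_left add.assoc)
        have "c * (e * a) + (e * w) * x \<preceq> c * (e * b) + (e * w) * y"
          using mult_left[OF c(2), of e] by (simp add: algebra_simps)
        thus "?r (e * a) (e * b)" using c(1) by blast
      qed
    qed
    thus False using assms by blast
  qed
  then obtain a b c w where *: "a \<in> T" "b \<in> T" "c \<noteq> 0" "c * a + w * x \<preceq> c * b + w * y" "\<phi> b < \<phi> a"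
    by force
  have "w \<noteq> 0"
  proof
    assume "w = 0"
    hence "a \<preceq> b" using mult_cancel[of c a b] * by simp
    thus False using phi_mono[of a b] * by simp
  qed
  thus thesis using that * by blast
qed

text \<open>
  The obstructions to \<open>y \<preceq> x\<close> and to \<open>x \<preceq> y\<close> involve \<open>w * (x - y)\<close> and \<open>v * (y - x)\<close>. Scaling
  by \<open>v\<close> and \<open>w\<close> makes these terms cancel.
\<close>
lemma total: "x \<preceq> y \<or> y \<preceq> x"
proof (rule ccontr)
  assume "\<not> ?thesis"
  hence xy: "\<not> x \<preceq> y" "\<not> y \<preceq> x" by auto
  obtain a b c w where 1: "a \<in> T" "b \<in> T" "c \<noteq> 0" "w \<noteq> 0" "c * a + w * x \<preceq> c * b + w * y" "\<phi> b < \<phi> a"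
    by (rule obstruction[OF xy(2)])
  obtain t s d v where 2: "t \<in> T" "s \<in> T" "d \<noteq> 0" "v \<noteq> 0" "d * t + v * y \<preceq> d * s + v * x" "\<phi> s < \<phi> t"
    by (rule obstruction[OF xy(1)])
  have "v * c * a + w * d * t + (v * w * x + v * w * y) = v * (c * a + w * x) + w * (d * t + v * y)"
    by (simp add: algebra_simps)
  also have "\<dots> \<preceq> v * (c * b + w * y) + w * (d * s + v * x)"
    by (intro add_mono mult_left 1 2)
  also have "\<dots> = v * c * b + w * d * s + (v * w * x + v * w * y)" by (simp add: algebra_simps)
  finally have "v * c * a + w * d * t \<preceq> v * c * b + w * d * s" by (rule add_cancel)
  hence "\<phi> a \<le> \<phi> b"
    using 1 2 by (intro weighted_comparison[of a b s t "v * c" "w * d"] mult_nonzero) auto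
  thus False using 1 by simp
qed

text \<open>
  Totality turns strict inequalities between values of \<open>\<psi>\<close> into inequalities in the semiring:
  each \<open>n * x\<close> lies between naturals whose distance from \<open>n * \<psi> x\<close> is at most \<open>1\<close>. Adding such
  bounds for \<open>x\<close> and \<open>y\<close> determines \<open>n * \<psi> (x + y)\<close> up to an error of \<open>2\<close>, for every \<open>n\<close>.
\<close>
lemma real_extension:
  obtains \<psi> where "monotone_hom_R (\<preceq>) UNIV \<psi>" "\<And>x. x \<in> T \<Longrightarrow> \<psi> x = \<phi> x"
proof -
  obtain \<psi> where psi: "\<And>x. 0 \<le> \<psi> x" "\<And>x y. \<psi> (x * y) = \<psi> x * \<psi> y"
    "\<And>x y. x \<preceq> y \<Longrightarrow> \<psi> x \<le> \<psi> y" "\<And>x. x \<in> T \<Longrightarrow> \<psi> x = \<phi> x"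
    using multiplicative_extension[OF total] by blast
  have nat: "\<psi> (of_nat n) = real n" "\<psi> (of_nat n * x) = real n * \<psi> x" for n x
    using psi(2,4) by (simp_all add: T_of_nat phi_of_nat)
  have below: "\<exists>i. of_nat i \<preceq> of_nat n * x \<and> real n * \<psi> x - 1 \<le> real i" for n x
  proof -
    \<comment> \<open>The largest integer strictly below \<open>n * \<psi> x\<close>; totality yields nothing at equality.
      For \<open>\<psi> x = 0\<close> the truncation to \<open>0\<close> is covered by \<open>0 \<preceq> n * x\<close>.\<close>
    define i where "i = nat (\<lceil>real n * \<psi> x\<rceil> - 1)"
    have "of_nat i \<preceq> of_nat n * x"
    proof (cases "i = 0")
      case False
      hence "real i < real n * \<psi> x" unfolding i_def by linarith
      hence "\<not> of_nat n * x \<preceq> of_nat i" using psi(3)[of "of_nat n * x" "of_nat i"] nat by auto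
      thus ?thesis using total by blast
    qed simp
    moreover have "real n * \<psi> x - 1 \<le> real i" unfolding i_def by linarith
    ultimately show ?thesis by blast
  qed
  have above: "\<exists>i. of_nat n * x \<preceq> of_nat i \<and> real i \<le> real n * \<psi> x + 1" for n x
  proof -
    define i where "i = nat (\<lfloor>real n * \<psi> x\<rfloor> + 1)"
    have nn: "0 \<le> real n * \<psi> x" using psi(1) by simp
    hence "real n * \<psi> x < real i" unfolding i_def by linarith
    hence "\<not> of_nat i \<preceq> of_nat n * x" using psi(3)[of "of_nat i" "of_nat n * x"] nat by auto
    hence "of_nat n * x \<preceq> of_nat i" using total by blast
    moreover have "real i \<le> real n * \<psi> x + 1" using nn unfolding i_def by linarith
    ultimately show ?thesis by blast
  qed
  have "\<psi> (x + y) = \<psi> x + \<psi> y" for x y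
  proof (rule antisym; rule le_if_multiples_le)
    fix n
    obtain i j where ij: "of_nat n * x \<preceq> of_nat i" "real i \<le> real n * \<psi> x + 1"
      "of_nat n * y \<preceq> of_nat j" "real j \<le> real n * \<psi> y + 1" using above by meson
    have "of_nat n * (x + y) \<preceq> of_nat (i + j)"
      using add_mono[OF ij(1,3)] by (simp add: distrib_left)
    hence "\<psi> (of_nat n * (x + y)) \<le> \<psi> (of_nat (i + j))" by (rule psi(3))
    thus "real n * \<psi> (x + y) \<le> real n * (\<psi> x + \<psi> y) + 2"
      unfolding nat using ij(2,4) by (simp add: distrib_left)
  next
    fix n
    obtain i j where ij: "of_nat i \<preceq> of_nat n * x" "real n * \<psi> x - 1 \<le> real i"
      "of_nat j \<preceq> of_nat n * y" "real n * \<psi> y - 1 \<le> real j" using below by meson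
    have "of_nat (i + j) \<preceq> of_nat n * (x + y)"
      using add_mono[OF ij(1,3)] by (simp add: distrib_left)
    hence "\<psi> (of_nat (i + j)) \<le> \<psi> (of_nat n * (x + y))" by (rule psi(3))
    thus "real n * (\<psi> x + \<psi> y) \<le> real n * \<psi> (x + y) + 2"
      unfolding nat using ij(2,4) by (simp add: distrib_left)
  qed
  hence "monotone_hom_R (\<preceq>) UNIV \<psi>"
    using psi phi_0 phi_1 T_0 T_1 by (auto simp: monotone_hom_R_def monotone_hom_wrt_def monotone_on_def)
  thus thesis using that psi(4) by blast
qed

end

section \<open>Totality and extension in the tropical case\<close>

locale maximal_tropical = maximal_growth_preorder +
  assumes phi_max: "x \<in> T \<Longrightarrow> y \<in> T \<Longrightarrow> \<phi> (x + y) = max (\<phi> x) (\<phi> y)"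
begin

lemma phi_of_nat_le: "\<phi> (of_nat n) \<le> 1"
  by (induction n) (auto simp: phi_0 phi_1 phi_max T_closed)

text \<open>
  Tropical homomorphisms do not distinguish \<open>n * y\<close> from \<open>y\<close> for \<open>n > 0\<close>, so neither does a
  maximal preorder. Hence addition is idempotent up to equivalence and sums are joins.
\<close>
lemma multiple_le: "of_nat n * x \<preceq> x"
proof (rule maximal[of "\<lambda>x y. \<exists>n. x \<preceq> of_nat n * y"])
  let ?r = "\<lambda>x y. \<exists>n. x \<preceq> of_nat n * y"
  show "?r (of_nat n * x) x" by blast
  show "?r x y" if "x \<preceq> y" for x y
    using that by (intro exI[of _ 1]) simp
  show "semiring_preorder ?r"
    unfolding semiring_preorder_def
  proof (intro conjI allI impI)
    show "reflp ?r" by (rule reflpI) (intro exI[of _ 1], simp)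
    show "transp ?r"
    proof (rule transpI)
      fix x y z assume "?r x y" "?r y z"
      then obtain m n where mn: "x \<preceq> of_nat m * y" "y \<preceq> of_nat n * z" by blast
      have "x \<preceq> of_nat m * (of_nat n * z)" using mn mult_left trans by blast
      also have "\<dots> = of_nat (m * n) * z" by (simp add: mult_ac)
      finally show "?r x z" by blast
    qed
    fix a x y assume "?r x y"
    then obtain n where n: "x \<preceq> of_nat n * y" by blast
    have "a + x \<preceq> a + of_nat n * y" by (rule add_left[OF n])
    also have "\<dots> \<preceq> (a + of_nat n * y) + (of_nat n * a + y)" by (rule le_add1)
    also have "\<dots> = of_nat (Suc n) * (a + y)" by (simp add: algebra_simps)
    finally show "?r (a + x) (a + y)" by blast
    show "?r (a * x) (a * y)" using mult_left[OF n, of a] by (auto simp: mult.left_commute)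
  qed
  fix x y assume xy: "x \<in> T" "y \<in> T" and "?r x y"
  then obtain n where "x \<preceq> of_nat n * y" by blast
  hence "\<phi> x \<le> \<phi> (of_nat n * y)" by (intro phi_mono T_closed xy)
  also have "\<dots> \<le> \<phi> y"
    using mult_right_mono[OF phi_of_nat_le nonneg[OF xy(2)]] by (simp add: phi_mult T_closed xy)
  finally show "\<phi> x \<le> \<phi> y" .
qed

lemma sum_le:
  assumes "\<And>i. i \<in> A \<Longrightarrow> f i \<preceq> z"
  shows "sum f A \<preceq> z"
  using assms
proof (induction A rule: infinite_finite_induct)
  case (insert i A)
  have "sum f (insert i A) \<preceq> z + z" using insert by (simp add: add_mono)
  also have "\<dots> \<preceq> z" using multiple_le[of 2 z] by (simp add: mult_2)
  finally show ?case .
qed auto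

text \<open>
  After multiplication by \<open>(x + y) ^ n\<close>, which can be cancelled, the left side expands into
  monomials of degree \<open>2 * n\<close>; each contains \<open>x ^ n\<close> or \<open>y ^ n\<close> as a factor.
\<close>
lemma power_add_le:
  assumes "x \<noteq> 0"
  shows "(x + y) ^ n \<preceq> x ^ n + y ^ n"
proof (rule mult_cancel)
  show "(x + y) ^ n \<noteq> 0" by (intro power_nonzero add_nonzero assms)
  have mono: "x ^ i * y ^ j \<preceq> (x + y) ^ (i + j)" for i j
    unfolding power_add by (intro mult_mono power_mono le_add1 le_add2)
  have "(x + y) ^ n * (x + y) ^ n = (\<Sum>k\<le>n+n. of_nat (n + n choose k) * x ^ k * y ^ (n + n - k))"
    unfolding binomial_ring[symmetric] by (simp add: power_add)
  also have "\<dots> \<preceq> (x + y) ^ n * (x ^ n + y ^ n)"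
  proof (rule sum_le)
    fix k assume k: "k \<in> {..n+n}"
    have "x ^ k * y ^ (n + n - k) \<preceq> (x + y) ^ n * (x ^ n + y ^ n)"
    proof (cases "n \<le> k")
      case True
      hence "x ^ k * y ^ (n + n - k) = x ^ n * (x ^ (k - n) * y ^ (n + n - k))"
        by (simp add: mult.assoc[symmetric] power_add[symmetric])
      also have "\<dots> \<preceq> (x ^ n + y ^ n) * (x + y) ^ (k - n + (n + n - k))"
        by (intro mult_mono mono le_add1)
      finally show ?thesis using True k by (simp add: mult.commute)
    next
      case False
      hence "x ^ k * y ^ (n + n - k) = y ^ n * (x ^ k * y ^ (n - k))"
        by (simp add: mult.left_commute power_add[symmetric])
      also have "\<dots> \<preceq> (x ^ n + y ^ n) * (x + y) ^ (k + (n - k))"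
        by (intro mult_mono mono le_add2)
      finally show ?thesis using False by (simp add: mult.commute)
    qed
    with multiple_le show "of_nat (n + n choose k) * x ^ k * y ^ (n + n - k) \<preceq> (x + y) ^ n * (x ^ n + y ^ n)"
      using trans unfolding mult.assoc by blast
  qed
  finally show "(x + y) ^ n * (x + y) ^ n \<preceq> (x + y) ^ n * (x ^ n + y ^ n)" .
qed

text \<open>
  Forcing \<open>y \<preceq> x\<close> identifies \<open>x + y\<close> with \<open>x\<close>. Since \<open>(x + y) / x \<ge> 1\<close>, allowing its powers as
  correction factors is compatible with adding a common term to both sides, and this gives a
  semiring preorder.
\<close>
lemma obstruction:
  assumes "\<not> y \<preceq> x"
  obtains a b n where "a \<in> T" "b \<in> T" "a * x ^ n \<preceq> b * (x + y) ^ n" "\<phi> b < \<phi> a"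
proof -
  let ?r = "\<lambda>a b. \<exists>n. a * x ^ n \<preceq> b * (x + y) ^ n"
  have "\<exists>a b. a \<in> T \<and> b \<in> T \<and> ?r a b \<and> \<not> \<phi> a \<le> \<phi> b"
  proof (rule ccontr)
    assume contra: "\<not> ?thesis"
    have "y \<preceq> x"
    proof (rule maximal[of ?r])
      show "?r y x" using mult_left[OF le_add2, of x y x] 
        by (intro exI[of _ 1]) (simp add: mult.commute)
      show "?r a b" if "a \<preceq> b" for a b
        using that by (intro exI[of _ 0]) simp
      show "\<phi> a \<le> \<phi> b" if "a \<in> T" "b \<in> T" "?r a b" for a b
        using contra that by blast
      show "semiring_preorder ?r"
        unfolding semiring_preorder_def
      proof (intro conjI allI impI)
        show "reflp ?r" by (rule reflpI) (intro exI[of _ 0], simp)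
        show "transp ?r"
        proof (rule transpI)
          fix a b c assume "?r a b" "?r b c"
          then obtain m n where m: "a * x ^ m \<preceq> b * (x + y) ^ m" and n: "b * x ^ n \<preceq> c * (x + y) ^ n" by blast
          have "a * x ^ (m + n) = x ^ n * (a * x ^ m)" by (simp add: power_add mult_ac)
          also have "\<dots> \<preceq> x ^ n * (b * (x + y) ^ m)" by (rule mult_left[OF m])
          also have "\<dots> = (x + y) ^ m * (b * x ^ n)" by (simp add: mult_ac)
          also have "\<dots> \<preceq> (x + y) ^ m * (c * (x + y) ^ n)" by (rule mult_left[OF n])
          also have "\<dots> = c * (x + y) ^ (m + n)" by (simp add: power_add mult_ac)
          finally show "?r a c" by blast
        qed
        fix e a b assume "?r a b"
        then obtain n where n: "a * x ^ n \<preceq> b * (x + y) ^ n" by blast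
        have "(e + a) * x ^ n = e * x ^ n + a * x ^ n" by (rule distrib_right)
        also have "\<dots> \<preceq> e * (x + y) ^ n + b * (x + y) ^ n"
          by (intro add_mono mult_left power_mono le_add1 n)
        also have "\<dots> = (e + b) * (x + y) ^ n" by (rule distrib_right[symmetric])
        finally show "?r (e + a) (e + b)" by blast
        show "?r (e * a) (e * b)" using mult_left[OF n, of e] by (auto simp: mult.assoc)
      qed
    qed
    thus False using assms by blast
  qed
  thus thesis using that by force
qed

text \<open>
  The obstructions say that \<open>a / b\<close> is at most a power of \<open>(x + y) / x\<close> and \<open>c / d\<close> at most a
  power of \<open>(x + y) / y\<close>. These two factors have trivial meet, hence so do \<open>a / b\<close> and \<open>c / d\<close>.
  Without division, this is \<open>a * c \<preceq> b * c + a * d\<close>, which contradicts \<open>\<phi> b < \<phi> a\<close> and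
  \<open>\<phi> d < \<phi> c\<close>.
\<close>
lemma total: "x \<preceq> y \<or> y \<preceq> x"
proof (rule ccontr)
  assume "\<not> ?thesis"
  hence xy: "\<not> x \<preceq> y" "\<not> y \<preceq> x" by auto
  hence x: "x \<noteq> 0" by auto
  obtain a b m where 1: "a \<in> T" "b \<in> T" "a * x ^ m \<preceq> b * (x + y) ^ m" "\<phi> b < \<phi> a"
    by (rule obstruction[OF xy(2)])
  obtain c d n where 2: "c \<in> T" "d \<in> T" "c * y ^ n \<preceq> d * (y + x) ^ n" "\<phi> d < \<phi> c"
    by (rule obstruction[OF xy(1)])
  \<comment> \<open>A common exponent; enlarging it is harmless because \<open>x\<close> and \<open>y\<close> lie below \<open>x + y\<close>.\<close>
  define N where "N = m + n"
  have a: "a * x ^ N \<preceq> b * (x + y) ^ N"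
    unfolding N_def power_add mult.assoc[symmetric] by (intro mult_mono 1 power_mono le_add1)
  have "c * y ^ N = c * y ^ n * y ^ m" by (simp add: N_def power_add mult_ac)
  also have "\<dots> \<preceq> d * (y + x) ^ n * (y + x) ^ m" by (intro mult_mono 2 power_mono le_add1)
  also have "\<dots> = d * (x + y) ^ N" by (simp add: N_def power_add add.commute mult_ac)
  finally have c: "c * y ^ N \<preceq> d * (x + y) ^ N" .
  have "(x ^ N + y ^ N) * (a * c) = c * (a * x ^ N) + a * (c * y ^ N)" by (simp add: algebra_simps)
  also have "\<dots> \<preceq> c * (b * (x + y) ^ N) + a * (d * (x + y) ^ N)"
    by (intro add_mono mult_left a c)
  also have "\<dots> = (x + y) ^ N * (b * c + a * d)" by (simp add: algebra_simps)
  also have "\<dots> \<preceq> (x ^ N + y ^ N) * (b * c + a * d)" by (intro mult_right power_add_le x)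
  finally have "a * c \<preceq> b * c + a * d"
    by (rule mult_cancel) (intro add_nonzero power_nonzero x)
  hence "\<phi> (a * c) \<le> \<phi> (b * c + a * d)" by (intro phi_mono T_closed 1 2)
  hence "\<phi> a * \<phi> c \<le> max (\<phi> b * \<phi> c) (\<phi> a * \<phi> d)"
    by (simp add: phi_mult phi_max T_closed 1 2)
  moreover have "\<phi> b * \<phi> c < \<phi> a * \<phi> c" "\<phi> a * \<phi> d < \<phi> a * \<phi> c"
    using 1(4) 2(4) nonneg[OF 1(2)] nonneg[OF 2(2)] by auto
  ultimately show False by linarith
qed

lemma tropical_extension:
  obtains \<psi> where "monotone_hom_TR (\<preceq>) UNIV \<psi>" "\<And>x. x \<in> T \<Longrightarrow> \<psi> x = \<phi> x"
proof -
  obtain \<psi> where psi: "\<And>x. 0 \<le> \<psi> x" "\<And>x y. \<psi> (x * y) = \<psi> x * \<psi> y"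
    "\<And>x y. x \<preceq> y \<Longrightarrow> \<psi> x \<le> \<psi> y" "\<And>x. x \<in> T \<Longrightarrow> \<psi> x = \<phi> x"
    using multiplicative_extension[OF total] by blast
  have *: "\<psi> (x + y) = \<psi> y" "\<psi> x \<le> \<psi> y" if "x \<preceq> y" for x y
  proof -
    have "x + y \<preceq> y + y" using that by (simp add: add_mono)
    also have "\<dots> \<preceq> y" using multiple_le[of 2 y] by (simp add: mult_2)
    finally show "\<psi> (x + y) = \<psi> y" using psi(3) le_add2 by (simp add: antisym)
  qed (rule psi(3)[OF that])
  have "\<psi> (x + y) = max (\<psi> x) (\<psi> y)" for x y
    using total[of x y] *[of x y] *[of y x] by (auto simp: add.commute max_def)
  hence "monotone_hom_TR (\<preceq>) UNIV \<psi>"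
    using psi phi_0 phi_1 T_0 T_1 by (auto simp: monotone_hom_TR_def monotone_hom_wrt_def monotone_on_def)
  thus thesis using that psi(4) by blast
qed

end

section \<open>The extension theorem\<close>

lemma monotone_hom_wrt_weaken:
  assumes "monotone_hom_wrt add r UNIV \<psi>" "\<And>x y. le x y \<Longrightarrow> r x y"
  shows "monotone_hom_wrt add le UNIV \<psi>"
  using assms by (auto simp: monotone_hom_wrt_def monotone_on_def)

theorem theorem7p17:
  fixes le :: "'a::comm_semiring_1 \<Rightarrow> 'a \<Rightarrow> bool" and u :: 'a and T :: "'a set"
  assumes "semiring_preorder le"
    and "le 0 1"
    and "power_universal le u"
    and "subsemiring T"
    and "u \<in> T"
  shows "(\<forall>\<phi>. monotone_hom_R le T \<phi> \<longrightarrow>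
            (\<exists>\<psi>. monotone_hom_R le UNIV \<psi> \<and> (\<forall>x\<in>T. \<psi> x = \<phi> x))) \<and>
         (\<forall>\<phi>. monotone_hom_TR le T \<phi> \<longrightarrow>
            (\<exists>\<psi>. monotone_hom_TR le UNIV \<psi> \<and> (\<forall>x\<in>T. \<psi> x = \<phi> x)))"
proof (intro conjI allI impI)
  fix \<phi> assume phi: "monotone_hom_R le T \<phi>"
  then interpret growth_preorder le u T \<phi>
    using growth_preorder_if_power_universal[OF assms] by (simp add: monotone_hom_R_def)
  obtain r where r: "\<And>x y. le x y \<Longrightarrow> r x y" "maximal_growth_preorder r u T \<phi>"
    using maximal_extension by blast
  interpret M: maximal_growth_preorder r u T \<phi> by (fact r(2))
  interpret M: maximal_real r u T \<phi>
    by unfold_locales (use phi in \<open>auto simp: monotone_hom_R_def monotone_hom_wrt_def\<close>)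
  obtain \<psi> where "monotone_hom_R r UNIV \<psi>" "\<And>x. x \<in> T \<Longrightarrow> \<psi> x = \<phi> x"
    using M.real_extension by blast
  thus "\<exists>\<psi>. monotone_hom_R le UNIV \<psi> \<and> (\<forall>x\<in>T. \<psi> x = \<phi> x)"
    using monotone_hom_wrt_weaken r(1) unfolding monotone_hom_R_def by blast
next
  fix \<phi> assume phi: "monotone_hom_TR le T \<phi>"
  then interpret growth_preorder le u T \<phi>
    using growth_preorder_if_power_universal[OF assms] by (simp add: monotone_hom_TR_def)
  obtain r where r: "\<And>x y. le x y \<Longrightarrow> r x y" "maximal_growth_preorder r u T \<phi>"
    using maximal_extension by blast
  interpret M: maximal_growth_preorder r u T \<phi> by (fact r(2))
  interpret M: maximal_tropical r u T \<phi>
    by unfold_locales (use phi in \<open>auto simp: monotone_hom_TR_def monotone_hom_wrt_def\<close>)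
  obtain \<psi> where "monotone_hom_TR r UNIV \<psi>" "\<And>x. x \<in> T \<Longrightarrow> \<psi> x = \<phi> x"
    using M.tropical_extension by blast
  thus "\<exists>\<psi>. monotone_hom_TR le UNIV \<psi> \<and> (\<forall>x\<in>T. \<psi> x = \<phi> x)"
    using monotone_hom_wrt_weaken r(1) unfolding monotone_hom_TR_def by blast
qed

end
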